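(* Let $$\mathrm{pt}=P_0\xleftarrow{\pi_1}P_1\xleftarrow{\pi_2}P_2\xleftarrow{}\cdots\xleftarrow{\pi_n}P_n$$ be a tower of cylindrical projections, where $\mathrm{pt}$ is the one-element poset. If each augmented pre-Reeb graph $\widehat R(\pi_i)$ is acyclic, then $\dim(P_n)=n$.
   Context: For a poset, $x\to y$ denotes a cover relation ($x<y$ with nothing strictly between). The (Dushnik–Miller) dimension $\dim(P)$ of a poset $P$ is the minimal $d$ such that there exists an order embedding $c:P\hookrightarrow\mathbb R^d$, i.e. a map with $x\le y\iff c(x)\le c(y)$ coordinatewise. A map $\pi:P\to Q$ of posets is a cylindrical projection if: (1) for every cover $v\to w$ in $P$, either $\pi(v)=\pi(w)$ or $\pi(v)\to\pi(w)$ is a cover in $Q$; (2) for every $q\in Q$ the fiber $\pi^{-1}(q)\subset P$ is a total order with at least 2 elements; (3) if $b(q)$ and $t(q)$ denote respectively the minimal and maximal elements of $\pi^{-1}(q)$, then the maps $b,t:Q\to P$ identify the Hasse diagram of $Q$ with induced subgraphs of the Hasse diagram of $P$; equivalently, for every cover $q\to q'$ in $Q$, the relations $b(q)\to b(q')$ and $t(q)\to t(q')$ are covers in $P$. Let $\pi:P\to Q$ be a cylindrical projection. A cover $v\to w$ in $P$ is horizontal if $\pi(v)\to\pi(w)$ is a cover in $Q$, and vertical if $\pi(v)=\pi(w)$. Let $\sim_h$ be the equivalence relation on $P$ generated by undirected adjacency along horizontal covers; $[v]$ denotes the class of $v$. The pre-Reeb graph $R(\pi)$ is the directed graph whose vertices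 are the $\sim_h$-equivalence classes, with an edge $[v]\to[w]$ whenever there exist representatives $v'\in[v]$, $w'\in[w]$ such that $v'\to w'$ is a vertical cover in $P$. The augmented pre-Reeb graph $\widehat R(\pi)$ is obtained from $R(\pi)$ by adding an auxiliary edge $[v]\to[w]$ whenever there exist representatives $v'\in[v]$, $w'\in[w]$ such that $\pi(w')<\pi(v')$ in $Q$ and $v',w'$ are incomparable in $P$. Acyclic means having no directed cycles (a loop counts as a directed cycle).
   Formalization: The posets in the tower are assumed finite; without this the claim fails, e.g. for the chain ω₁+1 over the one-element poset, whose augmented pre-Reeb graph is acyclic but which embeds in no R^d. *)

theory Defs
  imports Complex_Main "HOL-Library.FuncSet" "HOL-Library.Extended_Nat"
begin

text \<open>
  Posets are reflexive order relations in the sense of \<^theory>\<open>HOL.Order_Relation\<close>; the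
  underlying set of the poset \<open>P\<close> is \<^term>\<open>Field P\<close>. They are finite throughout: this
  is what makes the Hasse diagram determine the order, gives every fibre of a cylindrical
  projection a minimum and a maximum, and gives chains an embedding into the reals.
\<close>

definition finite_poset :: "'a rel \<Rightarrow> bool" where
  "finite_poset P \<longleftrightarrow> Partial_order P \<and> finite (Field P)"

definition covers :: "'a rel \<Rightarrow> 'a \<Rightarrow> 'a \<Rightarrow> bool" where
  "covers P x y \<longleftrightarrow> (x, y) \<in> P \<and> x \<noteq> y \<and>
     \<not> (\<exists>z. (x, z) \<in> P \<and> (z, y) \<in> P \<and> z \<noteq> x \<and> z \<noteq> y)"

text \<open>
  A point of \<open>d\<close>-dimensional real space is given by the values at \<open>0, \<dots>, d - 1\<close> of a
  function on the naturals; its other values are irrelevant.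
\<close>

definition order_embedding :: "'a rel \<Rightarrow> nat \<Rightarrow> ('a \<Rightarrow> nat \<Rightarrow> real) \<Rightarrow> bool" where
  "order_embedding P d c \<longleftrightarrow>
     (\<forall>x\<in>Field P. \<forall>y\<in>Field P. (x, y) \<in> P \<longleftrightarrow> (\<forall>i<d. c x i \<le> c y i))"

text \<open>The value is \<^term>\<open>\<infinity> :: enat\<close> exactly when there is no embedding in any dimension.\<close>

definition poset_dim :: "'a rel \<Rightarrow> enat" where
  "poset_dim P = Inf {enat d | d. \<exists>c. order_embedding P d c}"

definition fiber :: "'a rel \<Rightarrow> ('a \<Rightarrow> 'b) \<Rightarrow> 'b \<Rightarrow> 'a set" where
  "fiber P \<pi> q = {v \<in> Field P. \<pi> v = q}"

definition fiber_min :: "'a rel \<Rightarrow> ('a \<Rightarrow> 'b) \<Rightarrow> 'b \<Rightarrow> 'a" where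
  "fiber_min P \<pi> q = (THE v. v \<in> fiber P \<pi> q \<and> (\<forall>w\<in>fiber P \<pi> q. (v, w) \<in> P))"

definition fiber_max :: "'a rel \<Rightarrow> ('a \<Rightarrow> 'b) \<Rightarrow> 'b \<Rightarrow> 'a" where
  "fiber_max P \<pi> q = (THE v. v \<in> fiber P \<pi> q \<and> (\<forall>w\<in>fiber P \<pi> q. (w, v) \<in> P))"

text \<open>
  Monotonicity of \<open>\<pi>\<close> is not listed because, for finite posets, it follows from the
  condition on covers. The last two clauses say that \<^const>\<open>fiber_min\<close> and
  \<^const>\<open>fiber_max\<close> identify the Hasse diagram of \<open>Q\<close> with induced subgraphs of that of
  \<open>P\<close>; by \<open>cylindrical_projectionI\<close> below, only the left-to-right implications matter.
\<close>

definition cylindrical_projection :: "'a rel \<Rightarrow> 'b rel \<Rightarrow> ('a \<Rightarrow> 'b) \<Rightarrow> bool" where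
  "cylindrical_projection P Q \<pi> \<longleftrightarrow>
     \<pi> \<in> Field P \<rightarrow> Field Q \<and>
     (\<forall>v w. covers P v w \<longrightarrow> \<pi> v = \<pi> w \<or> covers Q (\<pi> v) (\<pi> w)) \<and>
     (\<forall>q\<in>Field Q. total_on (fiber P \<pi> q) P \<and> 2 \<le> card (fiber P \<pi> q)) \<and>
     (\<forall>q\<in>Field Q. \<forall>q'\<in>Field Q.
        covers Q q q' \<longleftrightarrow> covers P (fiber_min P \<pi> q) (fiber_min P \<pi> q')) \<and>
     (\<forall>q\<in>Field Q. \<forall>q'\<in>Field Q.
        covers Q q q' \<longleftrightarrow> covers P (fiber_max P \<pi> q) (fiber_max P \<pi> q'))"

definition horizontal_cover ::
  "'a rel \<Rightarrow> 'b rel \<Rightarrow> ('a \<Rightarrow> 'b) \<Rightarrow> 'a \<Rightarrow> 'a \<Rightarrow> bool" where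
  "horizontal_cover P Q \<pi> v w \<longleftrightarrow> covers P v w \<and> covers Q (\<pi> v) (\<pi> w)"

definition vertical_cover :: "'a rel \<Rightarrow> ('a \<Rightarrow> 'b) \<Rightarrow> 'a \<Rightarrow> 'a \<Rightarrow> bool" where
  "vertical_cover P \<pi> v w \<longleftrightarrow> covers P v w \<and> \<pi> v = \<pi> w"

definition h_equiv :: "'a rel \<Rightarrow> 'b rel \<Rightarrow> ('a \<Rightarrow> 'b) \<Rightarrow> 'a rel" where
  "h_equiv P Q \<pi> =
     {(v, w). v \<in> Field P \<and> w \<in> Field P \<and> equivclp (horizontal_cover P Q \<pi>) v w}"

text \<open>
  The pre-Reeb graph and its augmentation both have vertex set \<^term>\<open>Field P // h_equiv P Q \<pi>\<close>
  and are represented by their edge relations. Then \<^const>\<open>acyclic\<close> excludes all directed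
  cycles, including loops.
\<close>

definition pre_Reeb_graph :: "'a rel \<Rightarrow> 'b rel \<Rightarrow> ('a \<Rightarrow> 'b) \<Rightarrow> 'a set rel" where
  "pre_Reeb_graph P Q \<pi> =
     {(C, D). C \<in> Field P // h_equiv P Q \<pi> \<and> D \<in> Field P // h_equiv P Q \<pi> \<and>
        (\<exists>v\<in>C. \<exists>w\<in>D. vertical_cover P \<pi> v w)}"

definition augmented_pre_Reeb_graph :: "'a rel \<Rightarrow> 'b rel \<Rightarrow> ('a \<Rightarrow> 'b) \<Rightarrow> 'a set rel" where
  "augmented_pre_Reeb_graph P Q \<pi> = pre_Reeb_graph P Q \<pi> \<union>
     {(C, D). C \<in> Field P // h_equiv P Q \<pi> \<and> D \<in> Field P // h_equiv P Q \<pi> \<and>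
        (\<exists>v\<in>C. \<exists>w\<in>D. (\<pi> w, \<pi> v) \<in> Q \<and> \<pi> w \<noteq> \<pi> v \<and> (v, w) \<notin> P \<and> (w, v) \<notin> P)}"

lemma finite_chain_min:
  assumes "Partial_order P" "finite F" "F \<noteq> {}" "F \<subseteq> Field P" "total_on F P"
  shows "\<exists>m\<in>F. \<forall>w\<in>F. (m, w) \<in> P"
  using assms(2-5)
proof (induction F rule: finite_ne_induct)
  case (singleton x)
  then show ?case
    using assms(1) by (auto simp: partial_order_on_def preorder_on_def refl_on_def)
next
  case (insert x F)
  have refl: "(x, x) \<in> P" and trans: "trans P"
    using insert.prems assms(1) by (auto simp: partial_order_on_def preorder_on_def refl_on_def)
  obtain m where m: "m \<in> F" "\<forall>w\<in>F. (m, w) \<in> P"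
    using insert by (auto simp: total_on_def)
  have "(x, m) \<in> P \<or> (m, x) \<in> P"
    using insert.prems(2) m(1) refl by (auto simp: total_on_def)
  then show ?case
    using m refl transD[OF trans] by blast
qed

lemma fiber_min_props:
  assumes "finite_poset P" "total_on (fiber P \<pi> q) P" "fiber P \<pi> q \<noteq> {}"
  shows "fiber_min P \<pi> q \<in> fiber P \<pi> q" "\<forall>w\<in>fiber P \<pi> q. (fiber_min P \<pi> q, w) \<in> P"
proof -
  have P: "Partial_order P" and fin: "finite (Field P)"
    using assms(1) by (auto simp: finite_poset_def)
  have sub: "fiber P \<pi> q \<subseteq> Field P"
    by (auto simp: fiber_def)
  have "\<exists>m\<in>fiber P \<pi> q. \<forall>w\<in>fiber P \<pi> q. (m, w) \<in> P"
    by (rule finite_chain_min[OF P finite_subset[OF sub fin] assms(3) sub assms(2)])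
  moreover have "antisym P"
    using P by (simp add: partial_order_on_def)
  ultimately have "\<exists>!m. m \<in> fiber P \<pi> q \<and> (\<forall>w\<in>fiber P \<pi> q. (m, w) \<in> P)"
    by (blast dest: antisymD)
  from theI'[OF this] show "fiber_min P \<pi> q \<in> fiber P \<pi> q"
    "\<forall>w\<in>fiber P \<pi> q. (fiber_min P \<pi> q, w) \<in> P"
    unfolding fiber_min_def by blast+
qed

lemma fiber_max_props:
  assumes "finite_poset P" "total_on (fiber P \<pi> q) P" "fiber P \<pi> q \<noteq> {}"
  shows "fiber_max P \<pi> q \<in> fiber P \<pi> q" "\<forall>w\<in>fiber P \<pi> q. (w, fiber_max P \<pi> q) \<in> P"
proof -
  have eq: "fiber (P\<inverse>) \<pi> q = fiber P \<pi> q" "fiber_min (P\<inverse>) \<pi> q = fiber_max P \<pi> q"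
    by (auto simp: fiber_def fiber_min_def fiber_max_def)
  have "finite_poset (P\<inverse>)" "total_on (fiber (P\<inverse>) \<pi> q) (P\<inverse>)" "fiber (P\<inverse>) \<pi> q \<noteq> {}"
    using assms by (auto simp: finite_poset_def eq)
  from fiber_min_props[OF this] show "fiber_max P \<pi> q \<in> fiber P \<pi> q"
    "\<forall>w\<in>fiber P \<pi> q. (w, fiber_max P \<pi> q) \<in> P"
    by (auto simp: eq)
qed

lemma cylindrical_projectionI:
  assumes "finite_poset P"
    and map: "\<pi> \<in> Field P \<rightarrow> Field Q"
    and cov: "\<And>v w. covers P v w \<Longrightarrow> \<pi> v = \<pi> w \<or> covers Q (\<pi> v) (\<pi> w)"
    and fib: "\<And>q. q \<in> Field Q \<Longrightarrow> total_on (fiber P \<pi> q) P \<and> 2 \<le> card (fiber P \<pi> q)"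
    and mn: "\<And>q q'. covers Q q q' \<Longrightarrow> covers P (fiber_min P \<pi> q) (fiber_min P \<pi> q')"
    and mx: "\<And>q q'. covers Q q q' \<Longrightarrow> covers P (fiber_max P \<pi> q) (fiber_max P \<pi> q')"
  shows "cylindrical_projection P Q \<pi>"
proof -
  have ne: "fiber P \<pi> q \<noteq> {}" if "q \<in> Field Q" for q
    using fib[OF that] by auto
  have proj: "\<pi> (fiber_min P \<pi> q) = q" "\<pi> (fiber_max P \<pi> q) = q" if "q \<in> Field Q" for q
    using fiber_min_props(1)[OF assms(1), of \<pi> q] fiber_max_props(1)[OF assms(1), of \<pi> q]
      fib[OF that] ne[OF that] by (auto simp: fiber_def)
  have "covers Q q q'"
    if "q \<in> Field Q" "q' \<in> Field Q" "covers P (fiber_min P \<pi> q) (fiber_min P \<pi> q')" for q q'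
    using cov[OF that(3)] that by (auto simp: proj covers_def[of P])
  moreover have "covers Q q q'"
    if "q \<in> Field Q" "q' \<in> Field Q" "covers P (fiber_max P \<pi> q) (fiber_max P \<pi> q')" for q q'
    using cov[OF that(3)] that by (auto simp: proj covers_def[of P])
  ultimately show ?thesis
    unfolding cylindrical_projection_def using map cov fib mn mx by blast
qed

end

theory Submission
  imports Defs
begin

text \<open>
  Write \<open>\<pi> : P \<rightarrow> Q\<close> for one stage of the tower, \<open>b\<close> and \<open>t\<close> for the minimum and maximum of
  a fibre. Each stage raises the dimension by exactly one, for two independent reasons.

  Upper bound. An acyclic augmented pre-Reeb graph has a height function that increases strictly
  along edges. Pulled back to \<open>P\<close> it is constant along horizontal covers and increases along
  vertical ones, so it is monotone; and the auxiliary edges make it disagree with \<open>\<pi>\<close> on every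
  incomparable pair of \<open>P\<close> with strictly comparable projections. Hence an
  embedding of \<open>Q\<close>, composed with \<open>\<pi>\<close> and completed by this one extra coordinate, is an
  embedding of \<open>P\<close> (\<open>order_embedding_lift\<close>).

  Lower bound. An upward path of covers that starts in \<open>t(Q)\<close>
  can never leave \<open>t(Q)\<close>, so \<open>t(q) \<le> b(q')\<close> is impossible (\<open>fiber_max_not_le_fiber_min\<close>).
  Therefore \<open>b\<close> and \<open>t\<close> place two copies of \<open>Q\<close> in \<open>P\<close> that are related as in
  \<open>Q \<times> {0 < 1}\<close>, and inductively the top of the tower contains a Boolean lattice. Only its
  atoms and coatoms are followed through the tower: they form the standard example \<open>S\<^sub>n\<close>,
  which has no embedding in fewer than \<open>n\<close> dimensions (\<open>standard_example_dim_le\<close>).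
\<close>

section \<open>Finite posets and their covers\<close>

lemma finite_poset_refl: "finite_poset P \<Longrightarrow> x \<in> Field P \<Longrightarrow> (x, x) \<in> P"
  by (auto simp: finite_poset_def partial_order_on_def preorder_on_def refl_on_def)

lemma finite_poset_trans: "finite_poset P \<Longrightarrow> (x, y) \<in> P \<Longrightarrow> (y, z) \<in> P \<Longrightarrow> (x, z) \<in> P"
  by (auto simp: finite_poset_def partial_order_on_def preorder_on_def dest: transD)

lemma finite_poset_antisym: "finite_poset P \<Longrightarrow> (x, y) \<in> P \<Longrightarrow> (y, x) \<in> P \<Longrightarrow> x = y"
  by (auto simp: finite_poset_def partial_order_on_def dest: antisymD)

lemma coversD: "covers P x y \<Longrightarrow> (x, y) \<in> P \<and> x \<noteq> y"
  by (simp add: covers_def)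

lemma covers_in_Field: "covers P x y \<Longrightarrow> x \<in> Field P \<and> y \<in> Field P"
  by (auto simp: covers_def Field_def)

text \<open>
  Induction on the size of the interval: a point strictly between \<open>x\<close> and \<open>y\<close> splits it into
  two smaller ones.
\<close>

lemma le_imp_covers_path:
  assumes P: "finite_poset P" and "(x, y) \<in> P"
  shows "(covers P)\<^sup>*\<^sup>* x y"
  using assms(2)
proof (induction "card {z. (x, z) \<in> P \<and> (z, y) \<in> P}" arbitrary: x y rule: less_induct)
  case less
  let ?I = "\<lambda>x y. {z. (x, z) \<in> P \<and> (z, y) \<in> P}"
  have fin: "finite (?I x y)"
    by (rule finite_subset[of _ "Field P"]) (use P in \<open>auto simp: Field_def finite_poset_def\<close>)
  have ends: "x \<in> ?I x y" "y \<in> ?I x y"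
    using less.prems finite_poset_refl[OF P] by (auto simp: Field_def)
  consider "x = y" | "covers P x y"
    | z where "(x, z) \<in> P" "(z, y) \<in> P" "z \<noteq> x" "z \<noteq> y"
    using less.prems by (auto simp: covers_def)
  then show ?case
  proof cases
    case 3
    have "y \<notin> ?I x z" "x \<notin> ?I z y"
      using 3 finite_poset_antisym[OF P] by blast+
    moreover have "?I x z \<subseteq> ?I x y" "?I z y \<subseteq> ?I x y"
      using 3 finite_poset_trans[OF P] by blast+
    ultimately have "?I x z \<subset> ?I x y" "?I z y \<subset> ?I x y"
      using ends by blast+
    then have "(covers P)\<^sup>*\<^sup>* x z" "(covers P)\<^sup>*\<^sup>* z y"
      using less.hyps 3 psubset_card_mono[OF fin] by blast+
    then show ?thesis by (rule rtranclp_trans)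
  qed auto
qed

lemma covers_path_imp_le:
  assumes P: "finite_poset P" and "(covers P)\<^sup>*\<^sup>* x y" and "x \<in> Field P"
  shows "(x, y) \<in> P"
  using assms(2)
  by (induction rule: rtranclp_induct)
    (use assms(3) finite_poset_refl[OF P] finite_poset_trans[OF P] in \<open>auto dest: coversD\<close>)

lemma mono_if_covers_mono:
  assumes P: "finite_poset P" and Q: "finite_poset Q"
    and "\<And>x y. covers P x y \<Longrightarrow> (f x, f y) \<in> Q"
    and le: "(x, y) \<in> P" and "f x \<in> Field Q"
  shows "(f x, f y) \<in> Q"
  using le_imp_covers_path[OF P le]
  by (induction rule: rtranclp_induct)
    (use assms finite_poset_refl[OF Q] finite_poset_trans[OF Q] in blast)+

section \<open>Order structure of a cylindrical projection\<close>

locale cylinder =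
  fixes P :: "'a rel" and Q :: "'b rel" and \<pi> :: "'a \<Rightarrow> 'b"
  assumes P: "finite_poset P" and Q: "finite_poset Q" and cyl: "cylindrical_projection P Q \<pi>"
begin

abbreviation b where "b \<equiv> fiber_min P \<pi>"
abbreviation t where "t \<equiv> fiber_max P \<pi>"

lemma proj_in_Field: "v \<in> Field P \<Longrightarrow> \<pi> v \<in> Field Q"
  using cyl by (auto simp: cylindrical_projection_def)

lemma proj_covers: "covers P v w \<Longrightarrow> \<pi> v = \<pi> w \<or> covers Q (\<pi> v) (\<pi> w)"
  using cyl by (auto simp: cylindrical_projection_def)

lemma fiber_total: "q \<in> Field Q \<Longrightarrow> total_on (fiber P \<pi> q) P"
  using cyl by (auto simp: cylindrical_projection_def)

lemma fiber_card: "q \<in> Field Q \<Longrightarrow> 2 \<le> card (fiber P \<pi> q)"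
  using cyl by (auto simp: cylindrical_projection_def)

lemma fiber_nonempty: "q \<in> Field Q \<Longrightarrow> fiber P \<pi> q \<noteq> {}"
  using fiber_card by fastforce

lemma b_covers: "covers Q q q' \<Longrightarrow> covers P (b q) (b q')"
  using cyl covers_in_Field[of Q q q'] by (auto simp: cylindrical_projection_def)

lemma t_covers: "covers Q q q' \<Longrightarrow> covers P (t q) (t q')"
  using cyl covers_in_Field[of Q q q'] by (auto simp: cylindrical_projection_def)

lemma b_in_fiber: "q \<in> Field Q \<Longrightarrow> b q \<in> fiber P \<pi> q"
  using fiber_min_props(1)[OF P fiber_total fiber_nonempty] by blast

lemma t_in_fiber: "q \<in> Field Q \<Longrightarrow> t q \<in> fiber P \<pi> q"
  using fiber_max_props(1)[OF P fiber_total fiber_nonempty] by blast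

lemma
  assumes "q \<in> Field Q"
  shows b_in_Field: "b q \<in> Field P" and proj_b: "\<pi> (b q) = q"
    and t_in_Field: "t q \<in> Field P" and proj_t: "\<pi> (t q) = q"
  using b_in_fiber[OF assms] t_in_fiber[OF assms] by (auto simp: fiber_def)

lemma b_least: "v \<in> Field P \<Longrightarrow> (b (\<pi> v), v) \<in> P"
  using fiber_min_props(2)[OF P fiber_total fiber_nonempty] proj_in_Field
  by (fastforce simp: fiber_def)

lemma t_greatest: "v \<in> Field P \<Longrightarrow> (v, t (\<pi> v)) \<in> P"
  using fiber_max_props(2)[OF P fiber_total fiber_nonempty] proj_in_Field
  by (fastforce simp: fiber_def)

lemma proj_mono: "(v, w) \<in> P \<Longrightarrow> (\<pi> v, \<pi> w) \<in> Q"
proof (rule mono_if_covers_mono[OF P Q])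
  show "(\<pi> x, \<pi> y) \<in> Q" if "covers P x y" for x y
    using proj_covers[OF that] covers_in_Field[OF that] proj_in_Field finite_poset_refl[OF Q]
    by (auto dest: coversD)
qed (auto intro: proj_in_Field FieldI1)

lemma b_mono: "(q, q') \<in> Q \<Longrightarrow> (b q, b q') \<in> P"
  by (rule mono_if_covers_mono[OF Q P]) (auto dest: b_covers coversD intro: b_in_Field FieldI1)

lemma t_mono: "(q, q') \<in> Q \<Longrightarrow> (t q, t q') \<in> P"
  by (rule mono_if_covers_mono[OF Q P]) (auto dest: t_covers coversD intro: t_in_Field FieldI1)

lemma b_neq_t:
  assumes "q \<in> Field Q"
  shows "b q \<noteq> t q"
proof
  assume eq: "b q = t q"
  have "v = b q" if "v \<in> fiber P \<pi> q" for v
  proof -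
    have "v \<in> Field P" "\<pi> v = q" using that by (auto simp: fiber_def)
    then have "(b q, v) \<in> P" "(v, b q) \<in> P"
      using b_least[of v] t_greatest[of v] eq by auto
    then show ?thesis using finite_poset_antisym[OF P] by blast
  qed
  then have "fiber P \<pi> q \<subseteq> {b q}" by blast
  then have "card (fiber P \<pi> q) \<le> 1"
    using card_mono[of "{b q}"] by fastforce
  then show False using fiber_card[OF assms] by simp
qed

text \<open>
  A cover starting at \<open>t(q)\<close> cannot be vertical, so it lies over a cover \<open>q \<rightarrow> q'\<close> and ends at
  some \<open>w \<le> t(q')\<close>; since \<open>t(q) \<rightarrow> t(q')\<close> is itself a cover, \<open>w = t(q')\<close>.
\<close>

lemma fiber_max_up_closed:
  assumes "(t q, v) \<in> P" "q \<in> Field Q"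
  shows "v = t (\<pi> v)"
  using le_imp_covers_path[OF P assms(1)]
proof (induction rule: rtranclp_induct)
  case base
  show ?case by (simp add: proj_t assms(2))
next
  case (step v w)
  have w: "(v, w) \<in> P" "v \<noteq> w" "(w, t (\<pi> w)) \<in> P"
    using coversD[OF step.hyps(2)] covers_in_Field[OF step.hyps(2)] t_greatest by blast+
  from proj_covers[OF step.hyps(2)] show ?case
  proof
    assume "\<pi> v = \<pi> w"
    then have "(w, v) \<in> P" using w(3) step.IH by simp
    then show ?thesis using finite_poset_antisym[OF P] w(1,2) by blast
  next
    assume "covers Q (\<pi> v) (\<pi> w)"
    then have "covers P v (t (\<pi> w))" using t_covers step.IH by fastforce
    then show ?thesis using w unfolding covers_def by blast
  qed
qed

lemma fiber_max_not_le_fiber_min: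
  assumes "q \<in> Field Q" "q' \<in> Field Q"
  shows "(t q, b q') \<notin> P"
  using fiber_max_up_closed[OF _ assms(1)] b_neq_t[OF assms(2)] proj_b[OF assms(2)] by metis

end

section \<open>The height function of the augmented pre-Reeb graph\<close>

text \<open>The height of a vertex is the number of vertices from which it can be reached.\<close>

lemma acyclic_height:
  assumes "acyclic R" "R \<subseteq> V \<times> V" "finite V"
  obtains h :: "'c \<Rightarrow> nat" where "\<And>C D. (C, D) \<in> R \<Longrightarrow> h C < h D"
proof
  let ?h = "\<lambda>C. card {E. (E, C) \<in> R\<^sup>+}"
  fix C D assume CD: "(C, D) \<in> R"
  have "{E. (E, D) \<in> R\<^sup>+} \<subseteq> V"
    using trancl_subset_Sigma[OF assms(2)] by blast
  then have fin: "finite {E. (E, D) \<in> R\<^sup>+}"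
    using assms(3) finite_subset by blast
  have "{E. (E, C) \<in> R\<^sup>+} \<subseteq> {E. (E, D) \<in> R\<^sup>+}"
    using CD by (auto intro: trancl_into_trancl)
  moreover have "C \<in> {E. (E, D) \<in> R\<^sup>+}" "C \<notin> {E. (E, C) \<in> R\<^sup>+}"
    using CD assms(1) by (auto simp: acyclic_def)
  ultimately have "{E. (E, C) \<in> R\<^sup>+} \<subset> {E. (E, D) \<in> R\<^sup>+}" by blast
  then show "?h C < ?h D" by (rule psubset_card_mono[OF fin])
qed

lemma equiv_h_equiv: "equiv (Field P) (h_equiv P Q \<pi>)"
  by (rule equivI)
    (auto simp: h_equiv_def refl_on_def intro!: symI transI
      intro: equivclp_sym equivclp_trans)

context cylinder
begin

lemma height_function:
  assumes "acyclic (augmented_pre_Reeb_graph P Q \<pi>)"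
  obtains h :: "'a \<Rightarrow> nat"
  where "\<And>v w. horizontal_cover P Q \<pi> v w \<Longrightarrow> h v = h w"
    and "\<And>v w. vertical_cover P \<pi> v w \<Longrightarrow> h v < h w"
    and "\<And>v w. \<lbrakk>v \<in> Field P; w \<in> Field P; (\<pi> w, \<pi> v) \<in> Q; \<pi> w \<noteq> \<pi> v;
                 (v, w) \<notin> P; (w, v) \<notin> P\<rbrakk> \<Longrightarrow> h v < h w"
proof -
  let ?E = "h_equiv P Q \<pi>" and ?R = "augmented_pre_Reeb_graph P Q \<pi>"
  let ?V = "Field P // ?E"
  let ?cls = "\<lambda>v. ?E `` {v}"
  have sub: "?R \<subseteq> ?V \<times> ?V"
    by (auto simp: augmented_pre_Reeb_graph_def pre_Reeb_graph_def)
  have "?V \<subseteq> Pow (Field P)"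
    by (auto simp: quotient_def h_equiv_def)
  then have "finite ?V"
    using P by (auto simp: finite_poset_def dest: finite_subset)
  with acyclic_height[OF assms sub]
  obtain g :: "'a set \<Rightarrow> nat" where g: "\<And>C D. (C, D) \<in> ?R \<Longrightarrow> g C < g D"
    by blast
  have self: "v \<in> ?cls v" "?cls v \<in> ?V" if "v \<in> Field P" for v
    using that equiv_class_self[OF equiv_h_equiv that] by (auto intro: quotientI)
  show thesis
  proof
    fix v w
    show "g (?cls v) = g (?cls w)" if hor: "horizontal_cover P Q \<pi> v w"
    proof -
      have "(v, w) \<in> ?E"
        using hor covers_in_Field[of P v w] by (auto simp: h_equiv_def horizontal_cover_def intro: r_into_equivclp)
      then show ?thesis
        using equiv_class_eq[OF equiv_h_equiv] by metis
    qed
    show "g (?cls v) < g (?cls w)" if ver: "vertical_cover P \<pi> v w"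
    proof (rule g)
      have "v \<in> Field P" "w \<in> Field P"
        using ver covers_in_Field[of P v w] by (auto simp: vertical_cover_def)
      then show "(?cls v, ?cls w) \<in> ?R"
        unfolding augmented_pre_Reeb_graph_def pre_Reeb_graph_def using self ver by blast
    qed
    show "g (?cls v) < g (?cls w)"
      if "v \<in> Field P" "w \<in> Field P" "(\<pi> w, \<pi> v) \<in> Q" "\<pi> w \<noteq> \<pi> v" "(v, w) \<notin> P" "(w, v) \<notin> P"
    proof (rule g)
      show "(?cls v, ?cls w) \<in> ?R"
        unfolding augmented_pre_Reeb_graph_def using self that by blast
    qed
  qed
qed

section \<open>Upper bound on the dimension\<close>

text \<open>
  Within a fibre the height decides the order because a chain of covers between two points of
  the fibre is vertical throughout; between fibres an inequality of heights rules out the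
  auxiliary edge that incomparability would create.
\<close>

lemma le_iff_proj_height:
  fixes h :: "'a \<Rightarrow> nat"
  assumes hor: "\<And>v w. horizontal_cover P Q \<pi> v w \<Longrightarrow> h v = h w"
    and ver: "\<And>v w. vertical_cover P \<pi> v w \<Longrightarrow> h v < h w"
    and aux: "\<And>v w. \<lbrakk>v \<in> Field P; w \<in> Field P; (\<pi> w, \<pi> v) \<in> Q; \<pi> w \<noteq> \<pi> v;
                 (v, w) \<notin> P; (w, v) \<notin> P\<rbrakk> \<Longrightarrow> h v < h w"
    and x: "x \<in> Field P" and y: "y \<in> Field P"
  shows "(x, y) \<in> P \<longleftrightarrow> (\<pi> x, \<pi> y) \<in> Q \<and> h x \<le> h y"
proof
  have step: "h v \<le> h w" if "covers P v w" for v w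
    using proj_covers[OF that] hor[of v w] ver[of v w] that
    by (auto simp: horizontal_cover_def vertical_cover_def)
  have mono: "h v \<le> h w" if "(v, w) \<in> P" for v w
    using le_imp_covers_path[OF P that]
    by (induction rule: rtranclp_induct) (auto dest: step)
  show "(\<pi> x, \<pi> y) \<in> Q \<and> h x \<le> h y" if "(x, y) \<in> P"
    using proj_mono mono that by blast
  assume le: "(\<pi> x, \<pi> y) \<in> Q \<and> h x \<le> h y"
  show "(x, y) \<in> P"
  proof (rule ccontr)
    assume not: "(x, y) \<notin> P"
    show False
    proof (cases "\<pi> x = \<pi> y")
      case True
      have neq: "x \<noteq> y" using not x finite_poset_refl[OF P] by auto
      then have yx: "(y, x) \<in> P"
        using fiber_total[OF proj_in_Field[OF x]] x y True not
        by (auto simp: total_on_def fiber_def)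
      from le_imp_covers_path[OF P yx] neq
      obtain z where z: "covers P y z" "(covers P)\<^sup>*\<^sup>* z x"
        by (metis converse_rtranclpE)
      have "z \<in> Field P" using covers_in_Field[OF z(1)] by blast
      then have zx: "(z, x) \<in> P" using covers_path_imp_le[OF P z(2)] by blast
      have "(\<pi> y, \<pi> z) \<in> Q" "(\<pi> z, \<pi> y) \<in> Q"
        using proj_mono[OF zx] proj_mono[of y z] coversD[OF z(1)] True by auto
      then have "\<pi> y = \<pi> z" by (rule finite_poset_antisym[OF Q])
      then have "h y < h z" using ver z(1) by (auto simp: vertical_cover_def)
      then show False using mono[OF zx] le by simp
    next
      case False
      then have "(y, x) \<notin> P"
        using proj_mono[of y x] le finite_poset_antisym[OF Q] by blast
      then have "h y < h x" using aux[OF y x] le False not by blast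
      then show False using le by simp
    qed
  qed
qed

lemma order_embedding_lift:
  assumes "acyclic (augmented_pre_Reeb_graph P Q \<pi>)" and c: "order_embedding Q d c"
  shows "\<exists>c'. order_embedding P (Suc d) c'"
proof -
  from height_function[OF assms(1)] obtain h :: "'a \<Rightarrow> nat"
    where h: "\<And>v w. horizontal_cover P Q \<pi> v w \<Longrightarrow> h v = h w"
      "\<And>v w. vertical_cover P \<pi> v w \<Longrightarrow> h v < h w"
      "\<And>v w. \<lbrakk>v \<in> Field P; w \<in> Field P; (\<pi> w, \<pi> v) \<in> Q; \<pi> w \<noteq> \<pi> v;
         (v, w) \<notin> P; (w, v) \<notin> P\<rbrakk> \<Longrightarrow> h v < h w"
    by blast
  have "order_embedding P (Suc d) (\<lambda>x i. if i < d then c (\<pi> x) i else real (h x))"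
    unfolding order_embedding_def
  proof (intro ballI)
    fix x y assume xy: "x \<in> Field P" "y \<in> Field P"
    have "(x, y) \<in> P \<longleftrightarrow> (\<pi> x, \<pi> y) \<in> Q \<and> h x \<le> h y"
      by (rule le_iff_proj_height[OF h xy])
    also have "\<dots> \<longleftrightarrow> (\<forall>i<d. c (\<pi> x) i \<le> c (\<pi> y) i) \<and> h x \<le> h y"
      using c proj_in_Field[OF xy(1)] proj_in_Field[OF xy(2)] by (simp add: order_embedding_def)
    finally show "(x, y) \<in> P \<longleftrightarrow> (\<forall>i<Suc d. (if i < d then c (\<pi> x) i else real (h x))
        \<le> (if i < d then c (\<pi> y) i else real (h y)))"
      by (auto simp: All_less_Suc)
  qed
  then show ?thesis by blast
qed

end

section \<open>Lower bound on the dimension\<close>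

text \<open>
  The points \<open>a i\<close> and \<open>c i\<close> behave like the atoms and coatoms of a Boolean lattice of rank
  \<open>n\<close>. The bounds \<open>l\<close> and \<open>u\<close> play the part of its least and greatest elements; the next
  stage of a tower needs them to produce the new atom and coatom.
\<close>

definition bounded_standard_example ::
  "'a rel \<Rightarrow> nat \<Rightarrow> (nat \<Rightarrow> 'a) \<Rightarrow> (nat \<Rightarrow> 'a) \<Rightarrow> 'a \<Rightarrow> 'a \<Rightarrow> bool" where
  "bounded_standard_example P n a c l u \<longleftrightarrow>
     (l, u) \<in> P \<and>
     (\<forall>i<n. a i \<in> Field P \<and> c i \<in> Field P \<and> (a i, u) \<in> P \<and> (l, c i) \<in> P) \<and>
     (\<forall>i<n. \<forall>j<n. (a i, c j) \<in> P \<longleftrightarrow> i \<noteq> j)"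

text \<open>
  Each failure \<open>a i \<not>\<le> c i\<close> is witnessed by a coordinate. A coordinate \<open>k\<close> that served both
  \<open>i\<close> and \<open>j\<close> would give \<open>a i > c i \<ge> a j > c j \<ge> a i\<close> at \<open>k\<close>, so the witnesses are distinct.
\<close>

lemma standard_example_dim_le:
  assumes S: "bounded_standard_example P n a c l u" and e: "order_embedding P d e"
  shows "n \<le> d"
proof -
  have ac: "(\<forall>k<d. e (a i) k \<le> e (c j) k) \<longleftrightarrow> i \<noteq> j" if "i < n" "j < n" for i j
    using that S e unfolding bounded_standard_example_def order_embedding_def by blast
  have le: "e (a i) k \<le> e (c j) k" if "i < n" "j < n" "i \<noteq> j" "k < d" for i j k
    using ac[of i j] that by blast
  have "\<exists>k<d. e (c i) k < e (a i) k" if "i < n" for i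
    using ac[of i i] that by (auto simp: not_le)
  then obtain k where k: "\<And>i. i < n \<Longrightarrow> k i < d \<and> e (c i) (k i) < e (a i) (k i)"
    by metis
  have "inj_on k {..<n}"
  proof (rule inj_onI, rule ccontr)
    fix i j assume ij: "i \<in> {..<n}" "j \<in> {..<n}" "k i = k j" "i \<noteq> j"
    then show False
      using le[of i j "k i"] le[of j i "k i"] k[of i] k[of j] by auto
  qed
  moreover have "k ` {..<n} \<subseteq> {..<d}" using k by auto
  ultimately have "card {..<n} \<le> card {..<d}" by (intro card_inj_on_le) auto
  then show ?thesis by simp
qed

text \<open>
  The old atoms go to the bottom copy of \<open>Q\<close> and the old coatoms to the top copy. The new atom
  is the least element of the top copy, and the new coatom the greatest element of the bottom
  copy, as in \<open>Q \<times> {0 < 1}\<close>.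
\<close>

lemma (in cylinder) standard_example_lift:
  assumes "bounded_standard_example Q n a c l u"
  shows "bounded_standard_example P (Suc n)
           (\<lambda>i. if i < n then b (a i) else t l) (\<lambda>i. if i < n then t (c i) else b u) (b l) (t u)"
proof -
  have lu: "(l, u) \<in> Q" and l: "l \<in> Field Q" and u: "u \<in> Field Q"
    and a: "\<And>i. i < n \<Longrightarrow> a i \<in> Field Q \<and> (a i, u) \<in> Q"
    and c: "\<And>i. i < n \<Longrightarrow> c i \<in> Field Q \<and> (l, c i) \<in> Q"
    and ac: "\<And>i j. i < n \<Longrightarrow> j < n \<Longrightarrow> (a i, c j) \<in> Q \<longleftrightarrow> i \<noteq> j"
    using assms by (auto simp: bounded_standard_example_def Field_def)
  have bt: "(b q, t q') \<in> P \<longleftrightarrow> (q, q') \<in> Q" if "q \<in> Field Q" "q' \<in> Field Q" for q q'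
  proof
    show "(q, q') \<in> Q" if "(b q, t q') \<in> P"
      using proj_mono[OF that] proj_b proj_t \<open>q \<in> Field Q\<close> \<open>q' \<in> Field Q\<close> by simp
    show "(b q, t q') \<in> P" if "(q, q') \<in> Q"
      using b_mono[OF that] t_greatest[OF b_in_Field] \<open>q' \<in> Field Q\<close> finite_poset_trans[OF P]
      by (metis proj_b)
  qed
  show ?thesis
    unfolding bounded_standard_example_def
    using lu l u a c ac
    by (auto simp: less_Suc_eq bt b_in_Field t_in_Field b_mono t_mono
        fiber_max_not_le_fiber_min)
qed

theorem proposition1p12:
  fixes P :: "nat \<Rightarrow> 'a rel" and \<pi> :: "nat \<Rightarrow> 'a \<Rightarrow> 'a" and n :: nat
  assumes "\<And>i. i \<le> n \<Longrightarrow> finite_poset (P i)"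
    and "card (Field (P 0)) = 1"
    and "\<And>i. 1 \<le> i \<Longrightarrow> i \<le> n \<Longrightarrow> cylindrical_projection (P i) (P (i - 1)) (\<pi> i)"
    and "\<And>i. 1 \<le> i \<Longrightarrow> i \<le> n \<Longrightarrow>
           acyclic (augmented_pre_Reeb_graph (P i) (P (i - 1)) (\<pi> i))"
  shows "poset_dim (P n) = enat n"
proof -
  have cyl: "cylinder (P (Suc i)) (P i) (\<pi> (Suc i))" if "Suc i \<le> n" for i
  proof
    show "finite_poset (P (Suc i))" "finite_poset (P i)"
      using that by (auto intro: assms(1))
    show "cylindrical_projection (P (Suc i)) (P i) (\<pi> (Suc i))"
      using assms(3)[of "Suc i"] that by simp
  qed
  obtain p where p: "Field (P 0) = {p}"
    using assms(2) by (auto simp: card_1_singleton_iff)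
  have pp: "(p, p) \<in> P 0"
    using finite_poset_refl[OF assms(1)[of 0]] p by simp
  have "\<exists>e. order_embedding (P i) i e" if "i \<le> n" for i
    using that
  proof (induction i)
    case 0
    show ?case using p pp by (auto simp: order_embedding_def)
  next
    case (Suc i)
    then obtain e where "order_embedding (P i) i e" by auto
    moreover have "acyclic (augmented_pre_Reeb_graph (P (Suc i)) (P i) (\<pi> (Suc i)))"
      using assms(4)[of "Suc i"] Suc.prems by simp
    ultimately show ?case
      by (rule cylinder.order_embedding_lift[OF cyl[OF Suc.prems], rotated])
  qed
  then have upper: "\<exists>e. order_embedding (P n) n e" by simp
  have "\<exists>a c l u. bounded_standard_example (P i) i a c l u" if "i \<le> n" for i
    using that
  proof (induction i)
    case 0
    show ?case using pp by (auto simp: bounded_standard_example_def)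
  next
    case (Suc i)
    then obtain a c l u where "bounded_standard_example (P i) i a c l u" by auto
    then show ?case
      using cylinder.standard_example_lift[OF cyl[OF Suc.prems]] by blast
  qed
  then obtain a c l u where "bounded_standard_example (P n) n a c l u" by blast
  then have lower: "n \<le> d" if "order_embedding (P n) d e" for d e
    by (rule standard_example_dim_le[OF _ that])
  show ?thesis
    unfolding poset_dim_def
  proof (rule antisym)
    show "Inf {enat d |d. \<exists>e. order_embedding (P n) d e} \<le> enat n"
      by (rule Inf_lower) (use upper in blast)
    show "enat n \<le> Inf {enat d |d. \<exists>e. order_embedding (P n) d e}"
    proof (rule Inf_greatest)
      fix x assume "x \<in> {enat d |d. \<exists>e. order_embedding (P n) d e}"
      then obtain d e where "x = enat d" "order_embedding (P n) d e" by blast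
      then show "enat n \<le> x" using lower[of d e] by simp
    qed
  qed
qed

end
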